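(* Let $\mathcal{X}$ be a finite nonempty set of feasible solutions, let $S$ be a finite nonempty sample of weighting vectors in $W=\{w\in[0,1]^n:\sum_k w_k=1\}$, and for $w\in S$ let $f_w(x)=\sum_{k=1}^n w_k u_k(x)$, where $u(x)=(u_1(x),\dots,u_n(x))\in\mathbb{R}^n$ is the utility vector of $x\in\mathcal{X}$. Assume $f_w(x)\in[0,1]$ for all $w\in S$ and $x\in\mathcal{X}$. Let $A\subseteq\mathcal{X}$ be any nonempty initial subset. Then Algorithm $\mathrm{MMER}(\mathcal{X},A,S)$ (described in the context) terminates and returns a minmax expected regret solution together with its best challenger; that is, the returned pair $(x_A,\hat y)$ satisfies \[ x_A\in\arg\min_{x\in\mathcal{X}}\mathrm{MER}(x,\mathcal{X},S)\qquad\text{and}\qquad \hat y\in\arg\max_{y\in\mathcal{X}}\mathrm{PER}(x_A,y,S). \]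
   Context: **Regrets.** For $x,y\in\mathcal{X}$, \[ \mathrm{PER}(x,y,S)=\frac{1}{|S|}\sum_{w\in S}\max\{0,f_w(y)-f_w(x)\},\qquad \mathrm{MER}(x,\mathcal{X},S)=\max_{y\in\mathcal{X}}\mathrm{PER}(x,y,S), \] and $\mathrm{MMER}(\mathcal{X},S)=\min_{x\in\mathcal{X}}\mathrm{MER}(x,\mathcal{X},S)$. An $x$ attaining this minimum is a minmax expected regret solution. A best challenger of $x$ is an element of $\arg\max_{y\in\mathcal{X}}\mathrm{PER}(x,y,S)$. **Program $P_{\mathrm{MER}}$ for a fixed $x\in\mathcal{X}$** (variables $y$, $(b_w)_{w\in S}$, $(p_w)_{w\in S}$): \[ \begin{array}{ll} \max\ \frac{1}{|S|}\sum_{w\in S}[p_w-b_w f_w(x)] & \\ b_w\le f_w(y)-f_w(x)+1,\quad b_w\ge f_w(y)-f_w(x) & \forall w\in S,\\ p_w\le b_w,\quad p_w\le f_w(y),\quad p_w\ge b_w+f_w(y)-1 & \forall w\in S,\\ b_w\in\{0,1\},\quad p_w\in\mathbb{R}^+ & \forall w\in S,\\ y\in\mathcal{X}. & \end{array} \] **Program $P_A$ for a nonempty $A\subseteq\mathcal{X}$** (variables $x$, $t$, $(b^y_w)$, $(p^y_w)$ for $(w,y)\in S\times A$): \[ \begin{array}{ll} \min\ t & \\ t\ge\frac{1}{|S|}\sum_{w\in S}[b^y_w f_w(y)-p^y_w] & \forall y\in A,\\ b^y_w\le f_w(y)-f_w(x)+1,\quad b^y_w\ge f_w(y)-f_w(x)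 & \forall (w,y)\in S\times A,\\ p^y_w\le b^y_w,\quad p^y_w\le f_w(x),\quad p^y_w\ge b^y_w+f_w(x)-1 & \forall (w,y)\in S\times A,\\ b^y_w\in\{0,1\},\quad p^y_w\in\mathbb{R}^+ & \forall (w,y)\in S\times A,\\ x\in\mathcal{X},\quad t\in\mathbb{R}. & \end{array} \] This program is designed to compute $\min_{x\in\mathcal{X}}\max_{y\in A}\mathrm{PER}(x,y,S)$. **Algorithm $\mathrm{MMER}(\mathcal{X},A,S)$.** Set $\hat y\leftarrow\text{null}$. Repeat the following steps: 1. If $\hat y\ne\text{null}$, set $A\leftarrow A\cup\{\hat y\}$. 2. Solve $P_A$ to optimality. Let $\mathit{mmer}_A$ be its optimal value and $x_A$ the $x$-component of an (arbitrary) optimal solution. 3. Solve $P_{\mathrm{MER}}$ with $x=x_A$ to optimality. Let $\hat y$ be the $y$-component of an (arbitrary) optimal solution. Stop repeating as soon as, at the end of an iteration, $\hat y\in A$. Return $\mathit{mmer}_A$, $x_A$, $\hat y$. *)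

theory Defs
  imports "HOL-Analysis.Analysis"
begin

definition weights :: "(real ^ 'n) set" where
  "weights = {w. (\<forall>k. w $ k \<in> {0..1}) \<and> (\<Sum>k\<in>UNIV. w $ k) = 1}"

definition wsum :: "('a \<Rightarrow> real ^ 'n) \<Rightarrow> real ^ 'n \<Rightarrow> 'a \<Rightarrow> real" where
  "wsum u w x = (\<Sum>k\<in>UNIV. w $ k * u x $ k)"

text \<open>Pairwise expected regret and maximum expected regret. The latter is only meaningful for a
  finite nonempty set of alternatives.\<close>

definition PER :: "('a \<Rightarrow> real ^ 'n) \<Rightarrow> (real ^ 'n) set \<Rightarrow> 'a \<Rightarrow> 'a \<Rightarrow> real" where
  "PER u S x y = 1 / real (card S) * (\<Sum>w\<in>S. max 0 (wsum u w y - wsum u w x))"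

definition MER :: "('a \<Rightarrow> real ^ 'n) \<Rightarrow> 'a set \<Rightarrow> (real ^ 'n) set \<Rightarrow> 'a \<Rightarrow> real" where
  "MER u X S x = Max ((\<lambda>y. PER u S x y) ` X)"


text \<open>In both programs the variables indexed by \<open>w \<in> S\<close> (and \<open>y \<in> A\<close>) are represented by total
  functions whose values outside the index set are unconstrained and do not occur in the objective.
  Points of the first program are triples \<open>(y, b, p)\<close>, points of the second one are quadruples
  \<open>(x, t, b, p)\<close>.\<close>

fun P_MER_feasible ::
    "('a \<Rightarrow> real ^ 'n) \<Rightarrow> 'a set \<Rightarrow> (real ^ 'n) set \<Rightarrow> 'a \<Rightarrow>
      'a \<times> (real ^ 'n \<Rightarrow> real) \<times> (real ^ 'n \<Rightarrow> real) \<Rightarrow> bool" where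
  "P_MER_feasible u X S x (y, b, p) \<longleftrightarrow>
     (\<forall>w\<in>S. b w \<le> wsum u w y - wsum u w x + 1 \<and> b w \<ge> wsum u w y - wsum u w x) \<and>
     (\<forall>w\<in>S. p w \<le> b w \<and> p w \<le> wsum u w y \<and> p w \<ge> b w + wsum u w y - 1) \<and>
     (\<forall>w\<in>S. b w \<in> {0, 1} \<and> p w \<ge> 0) \<and>
     y \<in> X"

fun P_MER_objective ::
    "('a \<Rightarrow> real ^ 'n) \<Rightarrow> (real ^ 'n) set \<Rightarrow> 'a \<Rightarrow>
      'a \<times> (real ^ 'n \<Rightarrow> real) \<times> (real ^ 'n \<Rightarrow> real) \<Rightarrow> real" where
  "P_MER_objective u S x (y, b, p) = 1 / real (card S) * (\<Sum>w\<in>S. p w - b w * wsum u w x)"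

definition P_MER_optimal ::
    "('a \<Rightarrow> real ^ 'n) \<Rightarrow> 'a set \<Rightarrow> (real ^ 'n) set \<Rightarrow> 'a \<Rightarrow>
      'a \<times> (real ^ 'n \<Rightarrow> real) \<times> (real ^ 'n \<Rightarrow> real) \<Rightarrow> bool" where
  "P_MER_optimal u X S x = is_arg_max (P_MER_objective u S x) (P_MER_feasible u X S x)"

fun P_A_feasible ::
    "('a \<Rightarrow> real ^ 'n) \<Rightarrow> 'a set \<Rightarrow> (real ^ 'n) set \<Rightarrow> 'a set \<Rightarrow>
      'a \<times> real \<times> (real ^ 'n \<Rightarrow> 'a \<Rightarrow> real) \<times> (real ^ 'n \<Rightarrow> 'a \<Rightarrow> real) \<Rightarrow> bool" where
  "P_A_feasible u X S A (x, t, b, p) \<longleftrightarrow>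
     (\<forall>y\<in>A. t \<ge> 1 / real (card S) * (\<Sum>w\<in>S. b w y * wsum u w y - p w y)) \<and>
     (\<forall>w\<in>S. \<forall>y\<in>A. b w y \<le> wsum u w y - wsum u w x + 1 \<and> b w y \<ge> wsum u w y - wsum u w x) \<and>
     (\<forall>w\<in>S. \<forall>y\<in>A. p w y \<le> b w y \<and> p w y \<le> wsum u w x \<and> p w y \<ge> b w y + wsum u w x - 1) \<and>
     (\<forall>w\<in>S. \<forall>y\<in>A. b w y \<in> {0, 1} \<and> p w y \<ge> 0) \<and>
     x \<in> X"

fun P_A_objective ::
    "'a \<times> real \<times> (real ^ 'n \<Rightarrow> 'a \<Rightarrow> real) \<times> (real ^ 'n \<Rightarrow> 'a \<Rightarrow> real) \<Rightarrow> real" where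
  "P_A_objective (x, t, b, p) = t"

definition P_A_optimal ::
    "('a \<Rightarrow> real ^ 'n) \<Rightarrow> 'a set \<Rightarrow> (real ^ 'n) set \<Rightarrow> 'a set \<Rightarrow>
      'a \<times> real \<times> (real ^ 'n \<Rightarrow> 'a \<Rightarrow> real) \<times> (real ^ 'n \<Rightarrow> 'a \<Rightarrow> real) \<Rightarrow> bool" where
  "P_A_optimal u X S A = is_arg_min P_A_objective (P_A_feasible u X S A)"


text \<open>A state of the algorithm consists of the current set \<open>A\<close> and the triple
  \<open>(mmer\<^sub>A, x\<^sub>A, y)\<close> computed by the latest iteration, with \<open>None\<close> before the first iteration
  (when the challenger is still null). One step is one full iteration of the loop; it is a relation
  because the optimal solutions are chosen arbitrarily, and it is not enabled in a state in which
  the stopping test has succeeded.\<close>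

type_synonym 'a mmer_state = "'a set \<times> (real \<times> 'a \<times> 'a) option"

fun mmer_stopped :: "'a mmer_state \<Rightarrow> bool" where
  "mmer_stopped (A, None) \<longleftrightarrow> False"
| "mmer_stopped (A, Some (m, x, y)) \<longleftrightarrow> y \<in> A"

fun mmer_add_challenger :: "'a mmer_state \<Rightarrow> 'a set" where
  "mmer_add_challenger (A, None) = A"
| "mmer_add_challenger (A, Some (m, x, y)) = A \<union> {y}"

inductive mmer_step ::
    "('a \<Rightarrow> real ^ 'n) \<Rightarrow> 'a set \<Rightarrow> (real ^ 'n) set \<Rightarrow> 'a mmer_state \<Rightarrow> 'a mmer_state \<Rightarrow> bool"
  for u X S where
  "\<lbrakk> \<not> mmer_stopped s; A' = mmer_add_challenger s;
     P_A_optimal u X S A' (x, t, b, p); P_MER_optimal u X S x (y, b', p') \<rbrakk>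
   \<Longrightarrow> mmer_step u X S s (A', Some (t, x, y))"

end

theory Submission
  imports Defs
begin

text \<open>The integrality constraints force \<open>b\<close> to be the indicator of a positive regret (up to ties,
  which do not matter) and \<open>p\<close> to be the product it linearizes, so the two programs compute
  \<open>MER u X S x\<close> and \<open>min\<^sub>x MER u A S x\<close>. A challenger outside \<open>A\<close> enlarges \<open>A\<close> inside the finite
  set \<open>X\<close>, so the loop ends. When it ends with a challenger \<open>y \<in> A\<close>, then
  \<open>MER u X S x = PER u S x y \<le> MER u A S x \<le> MER u A S x' \<le> MER u X S x'\<close> for every \<open>x' \<in> X\<close>.\<close>

text \<open>If \<open>b = 0\<close>, then \<open>p \<le> b\<close> and \<open>p \<ge> 0\<close> pin
  \<open>p\<close> to 0; if \<open>b = 1\<close>, then \<open>p \<le> v\<close> and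
  \<open>p \<ge> b + v - 1\<close> pin it to \<open>v\<close>. The range of \<open>v\<close> makes
  the remaining inequalities hold.\<close>

lemma binary_product_linearization:
  fixes b p v :: real
  assumes "b \<in> {0, 1}" "v \<in> {0..1}"
  shows "p \<le> b \<and> p \<le> v \<and> p \<ge> b + v - 1 \<and> p \<ge> 0 \<longleftrightarrow> p = b * v"
  using assms by auto

text \<open>A positive \<open>d\<close> excludes \<open>b = 0\<close> and a negative
  \<open>d\<close> excludes \<open>b = 1\<close>. For \<open>d = 0\<close> both values of
  \<open>b\<close> remain, but the product vanishes anyway.\<close>

lemma binary_times_eq_positive_part:
  fixes b d :: real
  assumes "b \<in> {0, 1}" "b \<le> d + 1" "b \<ge> d"
  shows "b * d = max 0 d"
  using assms by auto

lemma PER_le_MER: "finite X \<Longrightarrow> y \<in> X \<Longrightarrow> PER u S x y \<le> MER u X S x"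
  unfolding MER_def by (rule Max_ge) auto

lemma MER_le_iff:
  "finite X \<Longrightarrow> X \<noteq> {} \<Longrightarrow> MER u X S x \<le> t \<longleftrightarrow> (\<forall>y\<in>X. PER u S x y \<le> t)"
  unfolding MER_def by (subst Max_le_iff) auto

lemma MER_subset_mono:
  "finite X \<Longrightarrow> A \<subseteq> X \<Longrightarrow> A \<noteq> {} \<Longrightarrow> MER u A S x \<le> MER u X S x"
  unfolding MER_def by (intro Max_mono image_mono) auto

locale bounded_utilities =
  fixes u :: "'a \<Rightarrow> real ^ 'n" and X :: "'a set" and S :: "(real ^ 'n) set"
  assumes finite_X: "finite X" and X_ne: "X \<noteq> {}"
    and wsum_unit: "\<And>w x. w \<in> S \<Longrightarrow> x \<in> X \<Longrightarrow> wsum u w x \<in> {0..1}"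
begin

section \<open>The program for a best challenger of a fixed alternative\<close>

lemma wsum_diff_le: "w \<in> S \<Longrightarrow> x \<in> X \<Longrightarrow> y \<in> X \<Longrightarrow> wsum u w y - wsum u w x \<le> 1"
  using wsum_unit[of w x] wsum_unit[of w y] by simp

lemma wsum_diff_ge: "w \<in> S \<Longrightarrow> x \<in> X \<Longrightarrow> y \<in> X \<Longrightarrow> 0 \<le> wsum u w y - wsum u w x + 1"
  using wsum_unit[of w x] wsum_unit[of w y] by simp

lemma P_MER_objective_eq_PER:
  assumes "P_MER_feasible u X S x (y, b, p)"
  shows "P_MER_objective u S x (y, b, p) = PER u S x y"
proof -
  have "p w - b w * wsum u w x = max 0 (wsum u w y - wsum u w x)" if w: "w \<in> S" for w
  proof -
    have "p w = b w * wsum u w y"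
      using assms w wsum_unit[of w y] binary_product_linearization[of "b w" "wsum u w y" "p w"]
      by auto
    moreover have "b w * (wsum u w y - wsum u w x) = max 0 (wsum u w y - wsum u w x)"
      using assms w by (intro binary_times_eq_positive_part) auto
    ultimately show ?thesis
      by (simp add: right_diff_distrib)
  qed
  then show ?thesis
    by (simp add: PER_def)
qed

lemma P_MER_feasible_exists:
  assumes "x \<in> X" "y \<in> X"
  shows "\<exists>b p. P_MER_feasible u X S x (y, b, p)"
proof -
  \<comment> \<open>Ties are sent to 0; the value 1 would satisfy the constraints as well.\<close>
  define b where "b w = (if wsum u w y > wsum u w x then 1 else 0 :: real)" for w
  have "P_MER_feasible u X S x (y, b, \<lambda>w. b w * wsum u w y)"
    using assms wsum_unit wsum_diff_le wsum_diff_ge by (auto simp: b_def)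
  then show ?thesis by blast
qed

text \<open>Every \<open>z \<in> X\<close> extends to a feasible point whose objective is its
  regret, so optimality among triples passes to the first component.\<close>

lemma P_MER_optimal_arg_max:
  assumes "x \<in> X" and opt: "P_MER_optimal u X S x (y, b, p)"
  shows "is_arg_max (PER u S x) (\<lambda>y. y \<in> X) y"
  unfolding is_arg_max_linorder
proof (intro conjI allI impI)
  have feas: "P_MER_feasible u X S x (y, b, p)"
    using opt by (auto simp: P_MER_optimal_def is_arg_max_linorder)
  then show "y \<in> X" by simp
  fix z assume "z \<in> X"
  then obtain b' p' where f: "P_MER_feasible u X S x (z, b', p')"
    using P_MER_feasible_exists assms(1) by blast
  then have "P_MER_objective u S x (z, b', p') \<le> P_MER_objective u S x (y, b, p)"
    using opt unfolding P_MER_optimal_def is_arg_max_linorder by blast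
  then show "PER u S x z \<le> PER u S x y"
    by (simp only: P_MER_objective_eq_PER[OF f] P_MER_objective_eq_PER[OF feas])
qed

text \<open>The feasible set need not be finite, as \<open>b\<close> and \<open>p\<close> are free
  outside \<open>S\<close>. An optimum is therefore lifted from a maximizer over the finite set
  \<open>X\<close>.\<close>

lemma P_MER_optimal_exists:
  assumes "x \<in> X"
  shows "\<exists>y b p. P_MER_optimal u X S x (y, b, p)"
proof -
  obtain y where y: "is_arg_max (PER u S x) (\<lambda>y. y \<in> X) y"
    using ex_is_arg_min_if_finite[OF finite_X X_ne, of "\<lambda>y. - PER u S x y"]
    by (auto simp: is_arg_min_linorder is_arg_max_linorder)
  then obtain b p where f: "P_MER_feasible u X S x (y, b, p)"
    using P_MER_feasible_exists assms unfolding is_arg_max_linorder by blast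
  have "P_MER_optimal u X S x (y, b, p)"
    unfolding P_MER_optimal_def is_arg_max_linorder
  proof (intro conjI allI impI f)
    fix q assume q: "P_MER_feasible u X S x q"
    obtain z b' p' where [simp]: "q = (z, b', p')" by (cases q)
    have "PER u S x z \<le> PER u S x y"
      using y q by (auto simp: is_arg_max_linorder)
    with q show "P_MER_objective u S x q \<le> P_MER_objective u S x (y, b, p)"
      by (simp only: P_MER_objective_eq_PER f \<open>q = _\<close>)
  qed
  then show ?thesis by blast
qed

section \<open>The program for minimizing the maximum regret against \<open>A\<close>\<close>

lemma P_A_feasible_imp_MER_le:
  assumes "A \<subseteq> X" "A \<noteq> {}" and feas: "P_A_feasible u X S A (x, t, b, p)"
  shows "MER u A S x \<le> t"
proof -
  have "PER u S x y \<le> t" if y: "y \<in> A" for y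
  proof -
    have "b w y * wsum u w y - p w y = max 0 (wsum u w y - wsum u w x)" if w: "w \<in> S" for w
    proof -
      \<comment> \<open>The roles are swapped compared with the other program: \<open>y\<close>
        ranges over the fixed set \<open>A\<close> and \<open>x\<close> is the variable, so
        \<open>p\<close> linearizes the product of \<open>b\<close> with the utility of
        \<open>x\<close>.\<close>
      have "p w y = b w y * wsum u w x"
        using feas w y wsum_unit[of w x]
          binary_product_linearization[of "b w y" "wsum u w x" "p w y"] by auto
      moreover have "b w y * (wsum u w y - wsum u w x) = max 0 (wsum u w y - wsum u w x)"
        using feas w y by (intro binary_times_eq_positive_part) auto
      ultimately show ?thesis
        by (simp add: right_diff_distrib)
    qed
    then have "PER u S x y = 1 / real (card S) * (\<Sum>w\<in>S. b w y * wsum u w y - p w y)"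
      by (simp add: PER_def)
    then show ?thesis using feas y by simp
  qed
  then show ?thesis
    using assms finite_X by (subst MER_le_iff) (auto intro: finite_subset)
qed

text \<open>The constraints bound \<open>t\<close> only from below, and this bound is attained:
  together with \<open>P_A_feasible_imp_MER_le\<close>, \<open>MER u A S x\<close> is the least
  feasible \<open>t\<close> for a given \<open>x\<close>.\<close>

lemma P_A_feasible_exists:
  assumes "A \<subseteq> X" "x \<in> X"
  shows "\<exists>b p. P_A_feasible u X S A (x, MER u A S x, b, p)"
proof -
  define b where "b w y = (if wsum u w y > wsum u w x then 1 else 0 :: real)" for w y
  have "1 / real (card S) * (\<Sum>w\<in>S. b w y * wsum u w y - b w y * wsum u w x) = PER u S x y" for y
    unfolding PER_def b_def by (intro arg_cong2[where f = "(*)"] refl sum.cong) auto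
  moreover have "PER u S x y \<le> MER u A S x" if "y \<in> A" for y
    using that assms finite_X by (intro PER_le_MER) (auto intro: finite_subset)
  moreover have "\<forall>w\<in>S. \<forall>y\<in>A. wsum u w y \<in> {0..1} \<and> wsum u w x \<in> {0..1}"
    using assms wsum_unit by blast
  ultimately have "P_A_feasible u X S A (x, MER u A S x, b, \<lambda>w y. b w y * wsum u w x)"
    using assms wsum_diff_le[of _ x] wsum_diff_ge[of _ x] unfolding P_A_feasible.simps
    by (auto simp: b_def)
  then show ?thesis by blast
qed

lemma P_A_optimal_arg_min:
  assumes A: "A \<subseteq> X" "A \<noteq> {}" and opt: "P_A_optimal u X S A (x, t, b, p)"
  shows "is_arg_min (MER u A S) (\<lambda>x. x \<in> X) x"
  unfolding is_arg_min_linorder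
proof (intro conjI allI impI)
  have feas: "P_A_feasible u X S A (x, t, b, p)"
    using opt by (auto simp: P_A_optimal_def is_arg_min_linorder)
  then show "x \<in> X" by simp
  fix z assume "z \<in> X"
  then obtain b' p' where "P_A_feasible u X S A (z, MER u A S z, b', p')"
    using P_A_feasible_exists A by blast
  then have "P_A_objective (x, t, b, p) \<le> P_A_objective (z, MER u A S z, b', p')"
    using opt unfolding P_A_optimal_def is_arg_min_linorder by blast
  \<comment> \<open>The optimal value \<open>t\<close> links both sides: it is at least
    \<open>MER u A S x\<close> and at most \<open>MER u A S z\<close>.\<close>
  with P_A_feasible_imp_MER_le[OF A feas] show "MER u A S x \<le> MER u A S z"
    by simp
qed

lemma P_A_optimal_exists:
  assumes A: "A \<subseteq> X" "A \<noteq> {}"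
  shows "\<exists>x t b p. P_A_optimal u X S A (x, t, b, p)"
proof -
  obtain x where x: "is_arg_min (MER u A S) (\<lambda>x. x \<in> X) x"
    using ex_is_arg_min_if_finite[OF finite_X X_ne] by blast
  then obtain b p where f: "P_A_feasible u X S A (x, MER u A S x, b, p)"
    using P_A_feasible_exists A unfolding is_arg_min_linorder by blast
  have "P_A_optimal u X S A (x, MER u A S x, b, p)"
    unfolding P_A_optimal_def is_arg_min_linorder
  proof (intro conjI allI impI f)
    fix q assume q: "P_A_feasible u X S A q"
    obtain z t b' p' where [simp]: "q = (z, t, b', p')" by (cases q)
    have "MER u A S x \<le> MER u A S z"
      using x q by (auto simp: is_arg_min_linorder)
    also have "\<dots> \<le> t"
      using q P_A_feasible_imp_MER_le[OF A] by simp
    finally show "P_A_objective (x, MER u A S x, b, p) \<le> P_A_objective q"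
      by simp
  qed
  then show ?thesis by blast
qed

section \<open>Invariant, termination and correctness of the loop\<close>

fun mmer_invariant :: "'a mmer_state \<Rightarrow> bool" where
  "mmer_invariant (B, r) \<longleftrightarrow> B \<subseteq> X \<and> B \<noteq> {} \<and>
     (\<forall>m x y. r = Some (m, x, y) \<longrightarrow>
        is_arg_min (MER u B S) (\<lambda>x. x \<in> X) x \<and> is_arg_max (PER u S x) (\<lambda>y. y \<in> X) y)"

lemma mmer_add_challenger_subset:
  assumes "mmer_invariant s"
  shows "mmer_add_challenger s \<subseteq> X" "mmer_add_challenger s \<noteq> {}"
  using assms by (cases s rule: mmer_add_challenger.cases; auto simp: is_arg_max_linorder)+

text \<open>Optimality of \<open>x\<close> is claimed only against the current set of challengers,
  which is why it holds after every iteration and not just the last.\<close>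

lemma mmer_invariant_step:
  assumes "mmer_step u X S s s'" "mmer_invariant s"
  shows "mmer_invariant s'"
  using assms(1)
proof cases
  case (1 A' x t b p y b' p')
  note A' = mmer_add_challenger_subset[OF assms(2)]
  have x: "is_arg_min (MER u A' S) (\<lambda>x. x \<in> X) x"
    using P_A_optimal_arg_min A' 1 by blast
  moreover have "is_arg_max (PER u S x) (\<lambda>y. y \<in> X) y"
    using x P_MER_optimal_arg_max 1 by (auto simp: is_arg_min_linorder)
  ultimately show ?thesis
    using A' 1 by simp
qed

lemma mmer_invariant_rtranclp:
  "(mmer_step u X S)\<^sup>*\<^sup>* s s' \<Longrightarrow> mmer_invariant s \<Longrightarrow> mmer_invariant s'"
  by (induction rule: rtranclp_induct) (auto intro: mmer_invariant_step)

lemma mmer_progress: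
  assumes "mmer_invariant s" "\<not> mmer_stopped s"
  shows "\<exists>s'. mmer_step u X S s s'"
proof -
  note A' = mmer_add_challenger_subset[OF assms(1)]
  obtain x t b p where opt: "P_A_optimal u X S (mmer_add_challenger s) (x, t, b, p)"
    using P_A_optimal_exists A' by blast
  then have "x \<in> X"
    using P_A_optimal_arg_min[OF A'] by (auto simp: is_arg_min_linorder)
  then obtain y b' p' where "P_MER_optimal u X S x (y, b', p')"
    using P_MER_optimal_exists by blast
  with opt assms show ?thesis
    by (blast intro: mmer_step.intros)
qed

text \<open>The extra unit pays for the first iteration, which leaves \<open>A\<close> unchanged.\<close>

fun mmer_rank :: "'a mmer_state \<Rightarrow> nat" where
  "mmer_rank (B, r) = card (X - B) + (if r = None then 1 else 0)"

lemma mmer_rank_decreases: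
  assumes "mmer_step u X S s s'" "mmer_invariant s"
  shows "mmer_rank s' < mmer_rank s"
  using assms(1)
proof cases
  case step: (1 A' x t b p y b' p')
  show ?thesis
  proof (cases s rule: mmer_add_challenger.cases)
    case (1 B)
    then show ?thesis using step by simp
  next
    case (2 B m z v)
    \<comment> \<open>A step is enabled only if the stopping test failed, so \<open>v\<close> is
      outside \<open>B\<close>; the invariant places it in \<open>X\<close>.\<close>
    then have "v \<in> X - B"
      using step assms(2) by (auto simp: is_arg_max_linorder)
    then have "card (X - B - {v}) < card (X - B)"
      using finite_X by (intro card_Diff1_less) auto
    moreover have "X - insert v B = X - B - {v}" by blast
    ultimately show ?thesis using 2 step by simp
  qed
qed

lemma mmer_terminates:
  assumes "mmer_invariant (\<sigma> 0)"
  shows "\<not> (\<forall>i. mmer_step u X S (\<sigma> i) (\<sigma> (Suc i)))"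
proof
  assume steps: "\<forall>i. mmer_step u X S (\<sigma> i) (\<sigma> (Suc i))"
  have "mmer_invariant (\<sigma> i)" for i
    by (induction i) (use assms steps mmer_invariant_step in blast)+
  then have "\<forall>i. (\<sigma> (Suc i), \<sigma> i) \<in> inv_image less_than mmer_rank"
    using steps mmer_rank_decreases by simp
  then show False
    using wf_inv_image[OF wf_less_than, of mmer_rank] by (auto simp: wf_iff_no_infinite_down_chain)
qed

lemma mmer_stopped_optimal:
  assumes "mmer_invariant (B, Some (m, x, y))" "y \<in> B"
  shows "is_arg_min (MER u X S) (\<lambda>x. x \<in> X) x"
  unfolding is_arg_min_linorder
proof (intro conjI allI impI)
  have B: "B \<subseteq> X" "B \<noteq> {}"
    and x: "is_arg_min (MER u B S) (\<lambda>x. x \<in> X) x"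
    and y: "is_arg_max (PER u S x) (\<lambda>y. y \<in> X) y"
    using assms(1) by auto
  show "x \<in> X" using x by (simp add: is_arg_min_linorder)
  fix z assume "z \<in> X"
  \<comment> \<open>The best challenger \<open>y\<close> attains the maximum regret of
    \<open>x\<close> over all of \<open>X\<close>.\<close>
  have "MER u X S x \<le> PER u S x y"
    using y finite_X X_ne by (simp add: MER_le_iff is_arg_max_linorder)
  \<comment> \<open>The stopping test enters here: \<open>y\<close> is already one of the
    challengers in \<open>B\<close>.\<close>
  also have "\<dots> \<le> MER u B S x"
    using assms(2) B finite_X by (intro PER_le_MER) (auto intro: finite_subset)
  also have "\<dots> \<le> MER u B S z"
    using x \<open>z \<in> X\<close> by (simp add: is_arg_min_linorder)
  also have "\<dots> \<le> MER u X S z"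
    using B finite_X by (intro MER_subset_mono)
  finally show "MER u X S x \<le> MER u X S z" .
qed

end

text \<open>Optimal solutions are chosen arbitrarily, so the claim covers all runs: none is
  infinite, none gets stuck before the stopping test succeeds, and each stopped state carries a
  correct pair.\<close>

theorem proposition3:
  fixes u :: "'a \<Rightarrow> real ^ 'n"
    and X A :: "'a set"
    and S :: "(real ^ 'n) set"
  assumes "finite X" and "X \<noteq> {}"
    and "finite S" and "S \<noteq> {}" and "S \<subseteq> weights"
    and "\<And>w x. w \<in> S \<Longrightarrow> x \<in> X \<Longrightarrow> wsum u w x \<in> {0..1}"
    and "A \<subseteq> X" and "A \<noteq> {}"
  shows "(\<nexists>\<sigma>. \<sigma> 0 = (A, None) \<and> (\<forall>i::nat. mmer_step u X S (\<sigma> i) (\<sigma> (Suc i)))) \<and>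
    (\<forall>s. (mmer_step u X S)\<^sup>*\<^sup>* (A, None) s \<longrightarrow> mmer_stopped s \<or> (\<exists>s'. mmer_step u X S s s')) \<and>
    (\<forall>B m x y. (mmer_step u X S)\<^sup>*\<^sup>* (A, None) (B, Some (m, x, y)) \<longrightarrow>
       mmer_stopped (B, Some (m, x, y)) \<longrightarrow>
       is_arg_min (MER u X S) (\<lambda>x. x \<in> X) x \<and>
       is_arg_max (PER u S x) (\<lambda>y. y \<in> X) y)"
proof -
  interpret bounded_utilities u X S
    using assms by unfold_locales
  have init: "mmer_invariant (A, None)"
    using assms by simp
  show ?thesis
  proof (intro conjI allI impI)
    show "\<nexists>\<sigma>. \<sigma> 0 = (A, None) \<and> (\<forall>i::nat. mmer_step u X S (\<sigma> i) (\<sigma> (Suc i)))"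
      using mmer_terminates init by metis
  next
    fix s assume "(mmer_step u X S)\<^sup>*\<^sup>* (A, None) s"
    then show "mmer_stopped s \<or> (\<exists>s'. mmer_step u X S s s')"
      using mmer_progress mmer_invariant_rtranclp init by blast
  next
    fix B m x y
    assume reach: "(mmer_step u X S)\<^sup>*\<^sup>* (A, None) (B, Some (m, x, y))"
      and stop: "mmer_stopped (B, Some (m, x, y))"
    have inv: "mmer_invariant (B, Some (m, x, y))"
      using mmer_invariant_rtranclp[OF reach init] .
    show "is_arg_min (MER u X S) (\<lambda>x. x \<in> X) x"
      using mmer_stopped_optimal[OF inv] stop by simp
    show "is_arg_max (PER u S x) (\<lambda>y. y \<in> X) y"
      using inv by simp
  qed
qed

end
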